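(* Let $G$ be a connected graph of order $n$, let $\tau>0$ be a real number such that $\frac{1}{\tau}\geq 2$ is an integer, let $\alpha\in\big[\frac{1}{2},\frac{3+\tau}{4+2\tau}\big)$, and suppose $$n\geq\max\Big\{2\tau^2+5\tau+\frac{2}{\tau}+8,\ \frac{(5-6\alpha)\tau^2+(13-14\alpha)\tau+4(1-\alpha)}{(1-2\alpha)\tau^2+(3-4\alpha)\tau}\Big\}.$$ If $\rho_{\alpha}(G)\geq\rho_{\alpha}\big(K_{1}\vee(K_{n-\frac{1}{\tau}-2}\cup(\frac{1}{\tau}+1)K_{1})\big)$, then $G$ is $\tau$-tough, unless $G\cong K_{1}\vee(K_{n-\frac{1}{\tau}-2}\cup(\frac{1}{\tau}+1)K_{1})$.
   Context: For a graph $G$, $A(G)$ is its adjacency matrix and $D(G)$ the diagonal matrix of vertex degrees. For $\alpha\in[0,1]$, $A_{\alpha}(G)=\alpha D(G)+(1-\alpha)A(G)$, and $\rho_{\alpha}(G)$ denotes the largest eigenvalue of $A_{\alpha}(G)$. $c(H)$ denotes the number of connected components of $H$. For a real $\tau>0$, a graph $G$ is $\tau$-tough if $|S|\geq\tau\,(c(G-S)-1)$ for every proper subset $S\subsetneq V(G)$ with $c(G-S)>1$ (a complete graph has no such $S$). $K_m$ is the complete graph on $m$ vertices, $kK_1$ is the edgeless graph on $k$ vertices, $\cup$ is disjoint union, and $G_1\vee G_2$ (join) is obtained from $G_1\cup G_2$ by adding all edges between $V(G_1)$ and $V(G_2)$. *)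

theory Defs
  imports Main "HOL-Analysis.Analysis"
begin

definition simple_graph :: "'a set \<Rightarrow> ('a \<Rightarrow> 'a \<Rightarrow> bool) \<Rightarrow> bool" where
  "simple_graph V E \<longleftrightarrow> finite V \<and> (\<forall>u v. E u v \<longrightarrow> E v u) \<and> (\<forall>u. \<not> E u u)
     \<and> (\<forall>u v. E u v \<longrightarrow> u \<in> V \<and> v \<in> V)"

definition degree :: "'a set \<Rightarrow> ('a \<Rightarrow> 'a \<Rightarrow> bool) \<Rightarrow> 'a \<Rightarrow> nat" where
  "degree V E u = card {v \<in> V. E u v}"

definition A_alpha :: "real \<Rightarrow> 'a set \<Rightarrow> ('a \<Rightarrow> 'a \<Rightarrow> bool) \<Rightarrow> 'a \<Rightarrow> 'a \<Rightarrow> real" where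
  "A_alpha \<alpha> V E u v =
     \<alpha> * (if u = v then real (degree V E u) else 0) + (1 - \<alpha>) * (if E u v then 1 else 0)"

definition is_eigenvalue_on :: "'a set \<Rightarrow> ('a \<Rightarrow> 'a \<Rightarrow> real) \<Rightarrow> real \<Rightarrow> bool" where
  "is_eigenvalue_on V M r \<longleftrightarrow>
     (\<exists>x :: 'a \<Rightarrow> real. (\<exists>v\<in>V. x v \<noteq> 0) \<and> (\<forall>u\<in>V. (\<Sum>w\<in>V. M u w * x w) = r * x u))"

definition rho_alpha :: "real \<Rightarrow> 'a set \<Rightarrow> ('a \<Rightarrow> 'a \<Rightarrow> bool) \<Rightarrow> real" where
  "rho_alpha \<alpha> V E = Max {r. is_eigenvalue_on V (A_alpha \<alpha> V E) r}"

definition reach_in :: "'a set \<Rightarrow> ('a \<Rightarrow> 'a \<Rightarrow> bool) \<Rightarrow> 'a \<Rightarrow> 'a \<Rightarrow> bool" where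
  "reach_in W E = (\<lambda>u v. E u v \<and> u \<in> W \<and> v \<in> W)\<^sup>*\<^sup>*"

definition num_components :: "'a set \<Rightarrow> ('a \<Rightarrow> 'a \<Rightarrow> bool) \<Rightarrow> nat" where
  "num_components W E = card ((\<lambda>v. {u \<in> W. reach_in W E v u}) ` W)"

definition connected_graph :: "'a set \<Rightarrow> ('a \<Rightarrow> 'a \<Rightarrow> bool) \<Rightarrow> bool" where
  "connected_graph V E \<longleftrightarrow> num_components V E = 1"

definition tough :: "real \<Rightarrow> 'a set \<Rightarrow> ('a \<Rightarrow> 'a \<Rightarrow> bool) \<Rightarrow> bool" where
  "tough \<tau> V E \<longleftrightarrow>
     (\<forall>S. S \<subset> V \<and> num_components (V - S) E > 1 \<longrightarrow>
          real (card S) \<ge> \<tau> * (real (num_components (V - S) E) - 1))"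

definition graph_iso :: "'a set \<Rightarrow> ('a \<Rightarrow> 'a \<Rightarrow> bool) \<Rightarrow> 'b set \<Rightarrow> ('b \<Rightarrow> 'b \<Rightarrow> bool) \<Rightarrow> bool" where
  "graph_iso V E V' E' \<longleftrightarrow>
     (\<exists>f. bij_betw f V V' \<and> (\<forall>u\<in>V. \<forall>v\<in>V. E u v \<longleftrightarrow> E' (f u) (f v)))"

text \<open>K_1 \<or> (K_{n-k-2} \<union> (k+1) K_1) on vertex set {0..<n}: vertex 0 is the K_1,
  vertices 1..n-k-2 form the clique K_{n-k-2}, vertices n-k-1..n-1 are the (k+1) K_1.\<close>
definition ext_graph_edges :: "nat \<Rightarrow> nat \<Rightarrow> nat \<Rightarrow> nat \<Rightarrow> bool" where
  "ext_graph_edges n k u v \<longleftrightarrow> u < n \<and> v < n \<and> u \<noteq> v \<and>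
     (u = 0 \<or> v = 0 \<or> (1 \<le> u \<and> u \<le> n - k - 2 \<and> 1 \<le> v \<and> v \<le> n - k - 2))"

end

theory Submission
  imports Defs "Jordan_Normal_Form.Spectral_Radius"
begin

text \<open>
  If \<open>G\<close> is not \<open>\<tau>\<close>-tough and \<open>k = 1 / \<tau>\<close>, some nonempty \<open>S\<close> of size \<open>s\<close> leaves at least \<open>k s + 2\<close>
  components. In both cases below the spectral radius is bounded by exhibiting a positive vector
  \<open>y\<close> with \<open>A\<^sub>\<alpha> y \<le> \<beta> y\<close>.

  For \<open>s \<ge> 2\<close> take \<open>y\<close> to be the degree vector. This bounds \<open>\<rho>\<^sub>\<alpha>(G)\<close> in terms of the number of
  edges, whose maximum is attained at \<open>s = 2\<close> by the first lower bound on \<open>n\<close>. The second one says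
  exactly that the resulting bound is at most \<open>n - k - 2\<close>; the extremal graph exceeds this value
  because it properly contains a clique on \<open>n - k - 1\<close> vertices.

  For \<open>s = 1\<close> let \<open>\<rho>\<close> be the spectral radius of the extremal graph and \<open>K = \<rho> + 1 - \<alpha>\<close>. Take \<open>y = 1\<close>
  at the cut vertex and \<open>y = (1 - \<alpha>) / (K - m)\<close> on a component of size \<open>m\<close>. All rows away from
  the cut vertex satisfy the inequality with \<open>\<beta> = \<rho>\<close>, and the row of the cut vertex does so by
  convexity of \<open>m / (K - m)\<close>. If \<open>\<rho>\<^sub>\<alpha>(G) \<ge> \<rho>\<close>, connectedness makes every row tight, which forces
  \<open>G\<close> to be the extremal graph.
\<close>

unbundle no vec_syntax

section \<open>Eigenvalues of symmetric matrices\<close>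

text \<open>Passing to a complex matrix gives access to finiteness and non-emptiness of its
  spectrum. Symmetry makes every complex eigenvalue real, and then the real or the imaginary part of
  a complex eigenvector is a real eigenvector.\<close>

lemma eigenvalues_on_eq_spectrum:
  fixes M :: "'a \<Rightarrow> 'a \<Rightarrow> real"
  assumes f: "bij_betw f {..<n} V" and sym: "\<And>u v. M u v = M v u"
  defines "A \<equiv> mat n n (\<lambda>(i, j). complex_of_real (M (f i) (f j)))"
  shows "{r. is_eigenvalue_on V M r} = {r. of_real r \<in> spectrum A}"
    and "spectrum A \<subseteq> \<real>"
proof -
  have A: "A \<in> carrier_mat n n" by (simp add: A_def)
  have V: "V = f ` {..<n}" using f by (auto simp: bij_betw_def)
  have sumV: "(\<Sum>w\<in>V. h w) = (\<Sum>j<n. h (f j))" for h :: "'a \<Rightarrow> 'c::comm_monoid_add"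
    using sum.reindex_bij_betw[OF f, of h] by simp
  have mv: "(A *\<^sub>v z) $ i = (\<Sum>j<n. of_real (M (f i) (f j)) * z $ j)"
    if "i < n" "z \<in> carrier_vec n" for i z
    using that by (auto simp: A_def scalar_prod_def atLeast0LessThan intro!: sum.cong)
  have ev: "of_real r \<in> spectrum A" if r: "is_eigenvalue_on V M r" for r
  proof -
    from r obtain x where x: "\<exists>v\<in>V. x v \<noteq> 0" "\<And>u. u \<in> V \<Longrightarrow> (\<Sum>w\<in>V. M u w * x w) = r * x u"
      by (auto simp: is_eigenvalue_on_def)
    define z where "z = vec n (\<lambda>i. complex_of_real (x (f i)))"
    have z: "z \<in> carrier_vec n" by (simp add: z_def)
    have "z \<noteq> 0\<^sub>v n"
    proof
      assume "z = 0\<^sub>v n"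
      then have "x (f i) = 0" if "i < n" for i
        using that by (metis index_vec index_zero_vec(1) of_real_eq_0_iff z_def)
      with x(1) V show False by auto
    qed
    moreover have "A *\<^sub>v z = of_real r \<cdot>\<^sub>v z"
    proof (rule eq_vecI)
      fix i assume "i < dim_vec (complex_of_real r \<cdot>\<^sub>v z)"
      then have i: "i < n" by (simp add: z_def)
      have "(A *\<^sub>v z) $ i = of_real (\<Sum>j<n. M (f i) (f j) * x (f j))"
        using mv[OF i z] by (simp add: z_def)
      also have "(\<Sum>j<n. M (f i) (f j) * x (f j)) = r * x (f i)"
        using x(2)[of "f i"] i V sumV[of "\<lambda>w. M (f i) w * x w"] by auto
      finally show "(A *\<^sub>v z) $ i = (of_real r \<cdot>\<^sub>v z) $ i" using i by (simp add: z_def)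
    qed (use A in \<open>simp add: z_def\<close>)
    ultimately show ?thesis
      using A z by (auto simp: spectrum_def eigenvalue_def eigenvector_def)
  qed
  have ve: "\<mu> \<in> \<real> \<and> is_eigenvalue_on V M (Re \<mu>)" if "\<mu> \<in> spectrum A" for \<mu>
  proof -
    from that A obtain z where z: "z \<in> carrier_vec n" "z \<noteq> 0\<^sub>v n" "A *\<^sub>v z = \<mu> \<cdot>\<^sub>v z"
      by (auto simp: spectrum_def eigenvalue_def eigenvector_def)
    define y where "y i = z $ i" for i
    have eq: "(\<Sum>j<n. of_real (M (f i) (f j)) * y j) = \<mu> * y i" if "i < n" for i
      using mv[OF that z(1)] z(1,3) that by (simp add: y_def)
    obtain i0 where i0: "i0 < n" "y i0 \<noteq> 0"
      using z(1,2) by (metis carrier_vecD eq_vecI index_zero_vec(1,2) y_def)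
    \<comment> \<open>\<open>q\<close> is the squared norm of the eigenvector. Evaluating the
      quadratic form by rows, and again by symmetry after swapping the sums, gives
      \<open>\<mu> * q = cnj \<mu> * q\<close>.\<close>
    define q where "q = (\<Sum>i<n. cnj (y i) * y i)"
    have q: "q = of_real (\<Sum>i<n. (cmod (y i))\<^sup>2)"
      unfolding q_def of_real_sum by (intro sum.cong refl) (simp only: mult.commute complex_norm_square)
    have "(\<Sum>i<n. (cmod (y i))\<^sup>2) > 0"
      by (rule sum_pos2[of _ i0]) (use i0 in auto)
    with q have q0: "q \<noteq> 0" by (metis less_irrefl of_real_eq_0_iff)
    have "\<mu> * q = (\<Sum>i<n. cnj (y i) * (\<Sum>j<n. of_real (M (f i) (f j)) * y j))"
      by (simp add: q_def sum_distrib_left eq mult.left_commute)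
    also have "\<dots> = (\<Sum>i<n. \<Sum>j<n. cnj (y i) * (of_real (M (f i) (f j)) * y j))"
      by (simp add: sum_distrib_left)
    also have "\<dots> = (\<Sum>j<n. \<Sum>i<n. cnj (y i) * (of_real (M (f i) (f j)) * y j))"
      by (rule sum.swap)
    also have "\<dots> = (\<Sum>j<n. y j * cnj (\<Sum>i<n. of_real (M (f j) (f i)) * y i))"
      by (simp add: sum_distrib_left sym[of "f _" "f _"] mult_ac)
    also have "\<dots> = cnj \<mu> * q"
      unfolding q_def sum_distrib_left
    proof (rule sum.cong[OF refl])
      fix j assume "j \<in> {..<n}"
      then have "j < n" by simp
      show "y j * cnj (\<Sum>i<n. of_real (M (f j) (f i)) * y i) = cnj \<mu> * (cnj (y j) * y j)"
        unfolding eq[OF \<open>j < n\<close>] by simp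
    qed
    finally have "\<mu> = cnj \<mu>" using q0 by simp
    then have real: "\<mu> \<in> \<real>" by (metis Reals_cnj_iff)
    then have mu: "\<mu> = of_real (Re \<mu>)" by simp
    \<comment> \<open>Matrix and eigenvalue are real, so \<open>Re\<close> and \<open>Im\<close> of
      the eigenvector both satisfy the eigenvalue equation; at \<open>i0\<close> one of them is
      nonzero.\<close>
    define x where "x p v = p (y (inv_into {..<n} f v))" for p :: "complex \<Rightarrow> real" and v
    have xf: "x p (f i) = p (y i)" if "i < n" for p i
      using f that by (simp add: x_def bij_betw_def inv_into_f_f)
    have row: "(\<Sum>w\<in>V. M u w * x p w) = Re \<mu> * x p u"
      if u: "u \<in> V" and p: "p = Re \<or> p = Im" for p u
    proof -
      obtain i where i: "u = f i" "i < n" using u V by auto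
      have "(\<Sum>w\<in>V. M u w * x p w) = p (\<Sum>j<n. of_real (M (f i) (f j)) * y j)"
        using p by (auto simp: sumV i xf)
      also have "\<dots> = p (of_real (Re \<mu>) * y i)" using eq[OF i(2)] mu by simp
      also have "\<dots> = Re \<mu> * x p u" using p i by (auto simp: xf)
      finally show ?thesis .
    qed
    have "Re (y i0) \<noteq> 0 \<or> Im (y i0) \<noteq> 0" using i0(2) by (simp add: complex_eq_iff)
    then have "\<exists>p. (p = Re \<or> p = Im) \<and> x p (f i0) \<noteq> 0" using xf[OF i0(1)] by auto
    then have "is_eigenvalue_on V M (Re \<mu>)"
      unfolding is_eigenvalue_on_def using row i0(1) V by blast
    with real show ?thesis by blast
  qed
  show "{r. is_eigenvalue_on V M r} = {r. of_real r \<in> spectrum A}"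
    using ev ve by fastforce
  show "spectrum A \<subseteq> \<real>" using ve by blast
qed

text \<open>\<open>rho_alpha\<close> is a \<open>Max\<close>, which is meaningful only for a finite
  nonempty set.\<close>

lemma eigenvalues_on_finite_nonempty:
  fixes M :: "'a \<Rightarrow> 'a \<Rightarrow> real"
  assumes "finite V" "V \<noteq> {}" and sym: "\<And>u v. M u v = M v u"
  shows "finite {r. is_eigenvalue_on V M r}" "{r. is_eigenvalue_on V M r} \<noteq> {}"
proof -
  obtain f where f: "bij_betw f {..<card V} V"
    using ex_bij_betw_nat_finite[OF assms(1)] by (auto simp: atLeast0LessThan)
  define A where "A = mat (card V) (card V) (\<lambda>(i, j). complex_of_real (M (f i) (f j)))"
  have A: "A \<in> carrier_mat (card V) (card V)" by (simp add: A_def)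
  note * = eigenvalues_on_eq_spectrum[of f "card V" V M, OF f sym, folded A_def]
  have "finite (complex_of_real -` spectrum A)"
    by (intro finite_vimageI card_finite_spectrum(1)[OF A]) (simp add: inj_def)
  then show "finite {r. is_eigenvalue_on V M r}" by (simp add: *(1) vimage_def)
  have "spectrum A \<noteq> {}"
    using spectrum_non_empty[OF A] assms(1,2) by (simp add: card_gt_0_iff)
  with *(2) obtain \<mu> where "\<mu> \<in> spectrum A" "\<mu> \<in> \<real>" by blast
  then show "{r. is_eigenvalue_on V M r} \<noteq> {}" unfolding *(1) by (auto elim: Reals_cases)
qed

section \<open>Comparison with a superharmonic vector\<close>

text \<open>Take \<open>q\<close> to be the largest ratio of the absolute value of the eigenvector
  to \<open>y\<close>. Then \<open>q * y\<close> dominates that absolute value and touches it at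
  \<open>u\<close>; \<open>q\<close> is positive because the eigenvector is nonzero.\<close>

lemma is_eigenvalue_on_max_ratio:
  fixes M :: "'a \<Rightarrow> 'a \<Rightarrow> real"
  assumes "finite V" and "\<And>v. v \<in> V \<Longrightarrow> y v > 0" and "is_eigenvalue_on V M r"
  obtains q u x where "q > 0" "u \<in> V" "\<bar>x u\<bar> = q * y u" "\<forall>v\<in>V. \<bar>x v\<bar> \<le> q * y v"
    "\<forall>v\<in>V. (\<Sum>w\<in>V. M v w * x w) = r * x v"
proof -
  obtain x where x: "\<exists>v\<in>V. x v \<noteq> 0" "\<And>v. v \<in> V \<Longrightarrow> (\<Sum>w\<in>V. M v w * x w) = r * x v"
    using assms(3) by (auto simp: is_eigenvalue_on_def)
  let ?R = "(\<lambda>v. \<bar>x v\<bar> / y v) ` V"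
  define q where "q = Max ?R"
  have R: "finite ?R" "?R \<noteq> {}" using assms(1) x(1) by auto
  obtain u where u: "u \<in> V" "q = \<bar>x u\<bar> / y u" using Max_in[OF R] q_def by auto
  have le: "\<bar>x v\<bar> / y v \<le> q" if "v \<in> V" for v
    unfolding q_def using R that by (intro Max_ge) auto
  obtain v where v: "v \<in> V" "x v \<noteq> 0" using x(1) by blast
  have "0 < \<bar>x v\<bar> / y v" using v assms(2) by simp
  with le[OF v(1)] have "q > 0" by linarith
  moreover have "\<bar>x u\<bar> = q * y u" using u assms(2)[of u] by simp
  moreover have "\<bar>x v\<bar> \<le> q * y v" if "v \<in> V" for v
    using le[OF that] assms(2)[OF that] by (simp add: field_simps)
  ultimately show ?thesis using that u(1) x(2) by blast
qed

lemma abs_eigen_row_le: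
  fixes M :: "'a \<Rightarrow> 'a \<Rightarrow> real"
  assumes "\<And>w. w \<in> V \<Longrightarrow> M u w \<ge> 0" and "(\<Sum>w\<in>V. M u w * x w) = r * x u"
  shows "r * \<bar>x u\<bar> \<le> (\<Sum>w\<in>V. M u w * \<bar>x w\<bar>)"
proof -
  have "r * \<bar>x u\<bar> \<le> \<bar>r * x u\<bar>" by (simp add: abs_mult mult_right_mono)
  also have "\<dots> \<le> (\<Sum>w\<in>V. \<bar>M u w * x w\<bar>)" unfolding assms(2)[symmetric] by (rule sum_abs)
  also have "\<dots> = (\<Sum>w\<in>V. M u w * \<bar>x w\<bar>)"
    using assms(1) by (intro sum.cong) (auto simp: abs_mult)
  finally show ?thesis .
qed

text \<open>In the row of a touching vertex \<open>u\<close>, the triangle inequality bounds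
  \<open>r * (q * y u)\<close> from above by \<open>\<beta> * (q * y u)\<close>, and the positive
  factor cancels.\<close>

lemma eigenvalue_le_of_superharmonic:
  fixes M :: "'a \<Rightarrow> 'a \<Rightarrow> real"
  assumes "finite V" and "\<And>v. v \<in> V \<Longrightarrow> y v > 0"
    and "\<And>u v. u \<in> V \<Longrightarrow> v \<in> V \<Longrightarrow> M u v \<ge> 0"
    and rows: "\<And>u. u \<in> V \<Longrightarrow> (\<Sum>v\<in>V. M u v * y v) \<le> \<beta> * y u"
    and "is_eigenvalue_on V M r"
  shows "r \<le> \<beta>"
proof -
  obtain q u x where x: "q > 0" "u \<in> V" "\<bar>x u\<bar> = q * y u" "\<forall>v\<in>V. \<bar>x v\<bar> \<le> q * y v"
    "\<forall>v\<in>V. (\<Sum>w\<in>V. M v w * x w) = r * x v"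
    by (rule is_eigenvalue_on_max_ratio[of V y M r, OF assms(1,2,5)])
  have "r * (q * y u) \<le> (\<Sum>w\<in>V. M u w * \<bar>x w\<bar>)"
    using abs_eigen_row_le[of V M u x r] assms(3) x by simp
  also have "\<dots> \<le> (\<Sum>w\<in>V. M u w * (q * y w))"
    using assms(3) x by (intro sum_mono mult_left_mono) auto
  also have "\<dots> = q * (\<Sum>w\<in>V. M u w * y w)" by (simp add: sum_distrib_left mult_ac)
  also have "\<dots> \<le> q * (\<beta> * y u)" using rows x by (intro mult_left_mono) auto
  finally have "r * (q * y u) \<le> \<beta> * (q * y u)" by (simp add: mult_ac)
  with x assms(2) show ?thesis by (simp add: mult_le_cancel_right_pos)
qed

text \<open>The equality case: when \<open>\<beta> \<le> r\<close>, the row of a touching vertex is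
  tight and all its neighbours are touching vertices too. Connectedness spreads this over
  \<open>V\<close>.\<close>

lemma superharmonic_rows_tight:
  fixes M :: "'a \<Rightarrow> 'a \<Rightarrow> real"
  assumes "finite V" and "\<And>v. v \<in> V \<Longrightarrow> y v > 0"
    and nonneg: "\<And>u v. u \<in> V \<Longrightarrow> v \<in> V \<Longrightarrow> M u v \<ge> 0"
    and rows: "\<And>u. u \<in> V \<Longrightarrow> (\<Sum>v\<in>V. M u v * y v) \<le> \<beta> * y u"
    and "is_eigenvalue_on V M r" and "\<beta> \<le> r"
    and pos: "\<And>u v. u \<in> V \<Longrightarrow> v \<in> V \<Longrightarrow> E u v \<Longrightarrow> M u v > 0"
    and conn: "\<And>u v. u \<in> V \<Longrightarrow> v \<in> V \<Longrightarrow> reach_in V E u v"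
    and "u \<in> V"
  shows "(\<Sum>v\<in>V. M u v * y v) = \<beta> * y u"
proof -
  obtain q a x where x: "q > 0" "a \<in> V" "\<bar>x a\<bar> = q * y a" "\<forall>v\<in>V. \<bar>x v\<bar> \<le> q * y v"
    "\<forall>v\<in>V. (\<Sum>w\<in>V. M v w * x w) = r * x v"
    by (rule is_eigenvalue_on_max_ratio[of V y M r, OF assms(1,2,5)])
  have step: "(\<Sum>w\<in>V. M v w * y w) = \<beta> * y v \<and> (\<forall>w\<in>V. E v w \<longrightarrow> \<bar>x w\<bar> = q * y w)"
    if v: "v \<in> V" "\<bar>x v\<bar> = q * y v" for v
  proof -
    have 1: "r * (q * y v) \<le> (\<Sum>w\<in>V. M v w * \<bar>x w\<bar>)"
      using abs_eigen_row_le[of V M v x r] nonneg x v by simp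
    have 2: "(\<Sum>w\<in>V. M v w * \<bar>x w\<bar>) \<le> (\<Sum>w\<in>V. M v w * (q * y w))"
      using nonneg x v by (intro sum_mono mult_left_mono) auto
    have 3: "(\<Sum>w\<in>V. M v w * (q * y w)) = q * (\<Sum>w\<in>V. M v w * y w)"
      by (simp add: sum_distrib_left mult_ac)
    have 4: "q * (\<Sum>w\<in>V. M v w * y w) \<le> q * (\<beta> * y v)"
      using rows x v by (intro mult_left_mono) auto
    have 5: "q * (\<beta> * y v) \<le> r * (q * y v)"
      using assms(2)[OF v(1)] x(1) \<open>\<beta> \<le> r\<close> by (simp add: mult.left_commute)
    \<comment> \<open>The facts 1 to 5 form a closed cycle of inequalities, so each of them is an
      equality.\<close>
    have "q * (\<Sum>w\<in>V. M v w * y w) = q * (\<beta> * y v)" using 1 2 3 4 5 by linarith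
    then have A: "(\<Sum>w\<in>V. M v w * y w) = \<beta> * y v" using x(1) by simp
    have "(\<Sum>w\<in>V. M v w * (q * y w - \<bar>x w\<bar>)) = 0"
      using 1 2 3 4 5 by (simp add: right_diff_distrib sum_subtractf)
    then have z: "\<forall>w\<in>V. M v w * (q * y w - \<bar>x w\<bar>) = 0"
      using nonneg x(4) v assms(1) by (subst (asm) sum_nonneg_eq_0_iff) auto
    have "\<bar>x w\<bar> = q * y w" if "w \<in> V" "E v w" for w
      using z pos[OF v(1) that] that by fastforce
    with A show ?thesis by blast
  qed
  have "reach_in V E a u" using conn x(2) \<open>u \<in> V\<close> by blast
  then have "u \<in> V \<and> \<bar>x u\<bar> = q * y u"
    unfolding reach_in_def by (induction rule: rtranclp_induct) (use x step in auto)
  then show ?thesis using step by blast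
qed

section \<open>Connected components\<close>

lemma reach_in_sym:
  assumes "simple_graph V E" "reach_in W E u v" shows "reach_in W E v u"
proof -
  have "symp (\<lambda>u v. E u v \<and> u \<in> W \<and> v \<in> W)"
    using assms(1) by (auto simp: simple_graph_def intro!: sympI)
  then show ?thesis using assms(2) sympD[OF symp_rtranclp] by (fastforce simp: reach_in_def)
qed

text \<open>Names the inner set of \<open>num_components\<close>, so that components can serve as
  the index set of sums.\<close>

definition component_in :: "'a set \<Rightarrow> ('a \<Rightarrow> 'a \<Rightarrow> bool) \<Rightarrow> 'a \<Rightarrow> 'a set" where
  "component_in W E v = {u \<in> W. reach_in W E v u}"

lemma num_components_eq: "num_components W E = card (component_in W E ` W)"
  by (simp add: num_components_def component_in_def[abs_def])

lemma self_in_component: "v \<in> W \<Longrightarrow> v \<in> component_in W E v"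
  by (simp add: component_in_def reach_in_def)

lemma component_in_subset: "component_in W E v \<subseteq> W"
  by (auto simp: component_in_def)

lemma neighbour_in_component: "v \<in> W \<Longrightarrow> u \<in> W \<Longrightarrow> E v u \<Longrightarrow> u \<in> component_in W E v"
  by (auto simp: component_in_def reach_in_def)

lemma component_in_eq:
  assumes "simple_graph V E" "u \<in> component_in W E v"
  shows "component_in W E u = component_in W E v"
proof -
  have vu: "reach_in W E v u" using assms(2) by (simp add: component_in_def)
  have uv: "reach_in W E u v" using reach_in_sym[OF assms(1) vu] .
  show ?thesis using vu uv
    by (auto simp: component_in_def reach_in_def intro: rtranclp_trans)
qed

text \<open>Components partition \<open>W\<close>, and the summand is constant on each of
  them.\<close>

lemma sum_over_components:
  fixes f :: "nat \<Rightarrow> real"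
  assumes "simple_graph V E" "finite W"
  shows "(\<Sum>v\<in>W. f (card (component_in W E v)))
    = (\<Sum>X\<in>component_in W E ` W. real (card X) * f (card X))"
proof -
  let ?P = "component_in W E ` W"
  have UP: "\<Union>?P = W" using self_in_component component_in_subset by fastforce
  have fin: "\<forall>X\<in>?P. finite X" using assms(2) by (auto intro: finite_subset[OF component_in_subset])
  have disj: "\<forall>X\<in>?P. \<forall>Y\<in>?P. X \<noteq> Y \<longrightarrow> X \<inter> Y = {}"
  proof (intro ballI impI)
    fix X Y assume "X \<in> ?P" "Y \<in> ?P" "X \<noteq> Y"
    then show "X \<inter> Y = {}" using component_in_eq[OF assms(1), of _ W] by blast
  qed
  have "(\<Sum>v\<in>W. f (card (component_in W E v))) = (\<Sum>v\<in>\<Union>?P. f (card (component_in W E v)))"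
    by (simp only: UP)
  also have "\<dots> = (\<Sum>X\<in>?P. \<Sum>v\<in>X. f (card (component_in W E v)))"
    using sum.Union_disjoint[OF fin disj] by simp
  also have "\<dots> = (\<Sum>X\<in>?P. \<Sum>v\<in>X. f (card X))"
    using component_in_eq[OF assms(1), of _ W] by (intro sum.cong refl) auto
  finally show ?thesis by simp
qed

lemma sum_component_sizes:
  assumes "simple_graph V E" "finite W"
  shows "(\<Sum>X\<in>component_in W E ` W. card X) = card W"
proof -
  have "real (card W) = real (\<Sum>X\<in>component_in W E ` W. card X)"
    using sum_over_components[OF assms, of "\<lambda>_. 1"] by simp
  then show ?thesis by linarith
qed

lemma component_size_pos:
  assumes "finite W" "X \<in> component_in W E ` W"
  shows "1 \<le> card X"
proof -
  have "finite X" "X \<noteq> {}"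
    using assms finite_subset[OF component_in_subset] self_in_component by fastforce+
  then show ?thesis by (simp add: Suc_le_eq card_gt_0_iff)
qed

text \<open>Every component other than \<open>X\<close> uses up at least one vertex.\<close>

lemma component_size_le:
  assumes "simple_graph V E" "finite W" "X \<in> component_in W E ` W"
  shows "card X + num_components W E \<le> card W + 1"
proof -
  let ?P = "component_in W E ` W"
  have "(\<Sum>Y\<in>?P - {X}. 1) \<le> (\<Sum>Y\<in>?P - {X}. card Y)"
    using component_size_pos[OF assms(2)] by (intro sum_mono) auto
  moreover have "(\<Sum>Y\<in>?P. card Y) = card X + (\<Sum>Y\<in>?P - {X}. card Y)"
    using assms(2,3) by (intro sum.remove) auto
  moreover have "card ?P = Suc (card (?P - {X}))"
    using assms(2,3) by (intro card.remove) auto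
  ultimately show ?thesis using sum_component_sizes[OF assms(1,2)]
    by (simp add: num_components_eq)
qed

lemma connected_graph_reach:
  assumes "simple_graph V E" "connected_graph V E" "u \<in> V" "v \<in> V"
  shows "reach_in V E u v"
proof -
  have "card (component_in V E ` V) = 1"
    using assms(2) by (simp add: connected_graph_def num_components_eq)
  then have "component_in V E u = component_in V E v"
    using assms(3,4) by (metis card_1_singletonE imageI singletonD)
  with assms(4) self_in_component[of v V E] show ?thesis by (auto simp: component_in_def)
qed

section \<open>The extremal graph\<close>

lemma A_alpha_row:
  assumes "finite V" "u \<in> V"
  shows "(\<Sum>w\<in>V. A_alpha \<alpha> V E u w * x w)
    = \<alpha> * real (Defs.degree V E u) * x u + (1 - \<alpha>) * (\<Sum>w | w \<in> V \<and> E u w. x w)"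
proof -
  have "(\<Sum>w\<in>V. A_alpha \<alpha> V E u w * x w)
    = (\<Sum>w\<in>V. (if u = w then \<alpha> * real (Defs.degree V E u) * x w else 0)
        + (if E u w then (1 - \<alpha>) * x w else 0))"
    by (intro sum.cong) (auto simp: A_alpha_def algebra_simps)
  also have "\<dots> = \<alpha> * real (Defs.degree V E u) * x u + (\<Sum>w | w \<in> V \<and> E u w. (1 - \<alpha>) * x w)"
    using assms by (simp add: sum.distrib sum.inter_filter)
  finally show ?thesis by (simp add: sum_distrib_left)
qed

text \<open>By convexity of \<open>m / (K - m)\<close>, each term lies below the chord through
  \<open>m = 1\<close> and \<open>m = N\<close>. The sum of the chord values depends only on the
  number of parts and decreases with it. Equality forces exactly \<open>k + 2\<close> parts, each of
  size 1 or \<open>N\<close>. The parts will be the component sizes left by a cut vertex.\<close>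

lemma fraction_sum:
  fixes m :: "'i \<Rightarrow> nat" and K :: real
  assumes "finite I" and "\<And>i. i \<in> I \<Longrightarrow> 1 \<le> m i" and "\<And>i. i \<in> I \<Longrightarrow> m i \<le> N"
    and total: "(\<Sum>i\<in>I. m i) = N + k + 1" and "card I \<ge> k + 2" and K: "real N < K" and "N \<ge> 1"
  shows "(\<Sum>i\<in>I. m i / (K - m i)) \<le> real N / (K - real N) + (real k + 1) / (K - 1)"
    and "(\<Sum>i\<in>I. m i / (K - m i)) = real N / (K - real N) + (real k + 1) / (K - 1)
      \<Longrightarrow> \<exists>i\<in>I. m i = N \<and> (\<forall>j\<in>I - {i}. m j = 1)"
proof -
  \<comment> \<open>For \<open>N > 1\<close> this is the slope of the chord of
    \<open>m / (K - m)\<close> between \<open>m = 1\<close> and \<open>m = N\<close>.\<close>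
  define \<sigma> where "\<sigma> = K / ((K - N) * (K - 1))"
  define c where "c = card I"
  have K1: "K > 1" using assms by linarith
  have \<sigma>: "1 / (K - 1) < \<sigma>"
  proof -
    have "1 / (K - 1) = (K - N) / ((K - N) * (K - 1))" using K by simp
    also have "\<dots> < \<sigma>"
      unfolding \<sigma>_def using K K1 \<open>N \<ge> 1\<close> by (intro divide_strict_right_mono) auto
    finally show ?thesis .
  qed
  \<comment> \<open>The coefficient of \<open>real j - 1\<close> grows with \<open>j\<close> and
    equals \<open>\<sigma>\<close> at \<open>j = N\<close>; this is the convexity used
    below.\<close>
  have frac: "real j / (K - j) = 1 / (K - 1) + (real j - 1) * K / ((K - j) * (K - 1))"
    if "j \<le> N" for j :: nat
  proof -
    have "K - j > 0" using K that by linarith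
    then have "real j / (K - j) = real j * (K - 1) / ((K - j) * (K - 1))"
      and "1 / (K - 1) = (K - j) / ((K - j) * (K - 1))"
      using K1 by simp_all
    then show ?thesis by (simp only: flip: add_divide_distrib) (simp add: algebra_simps)
  qed
  have le: "m i / (K - m i) \<le> 1 / (K - 1) + (real (m i) - 1) * \<sigma>"
    and strict: "1 < m i \<Longrightarrow> m i < N \<Longrightarrow> m i / (K - m i) < 1 / (K - 1) + (real (m i) - 1) * \<sigma>"
    if "i \<in> I" for i
  proof -
    have *: "1 \<le> m i" "m i \<le> N" using that assms by auto
    have "K / ((K - m i) * (K - 1)) \<le> \<sigma>"
      unfolding \<sigma>_def using K K1 * by (intro divide_left_mono mult_right_mono) auto
    then have "(real (m i) - 1) * (K / ((K - m i) * (K - 1))) \<le> (real (m i) - 1) * \<sigma>"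
      using * by (intro mult_left_mono) auto
    then show "m i / (K - m i) \<le> 1 / (K - 1) + (real (m i) - 1) * \<sigma>" using frac[OF *(2)] by simp
    assume **: "1 < m i" "m i < N"
    have "K / ((K - m i) * (K - 1)) < \<sigma>"
      unfolding \<sigma>_def using K K1 ** by (intro divide_strict_left_mono mult_strict_right_mono) auto
    then have "(real (m i) - 1) * (K / ((K - m i) * (K - 1))) < (real (m i) - 1) * \<sigma>"
      using ** by (intro mult_strict_left_mono) auto
    then show "m i / (K - m i) < 1 / (K - 1) + (real (m i) - 1) * \<sigma>" using frac[OF *(2)] by simp
  qed
  have total': "(\<Sum>i\<in>I. real (m i) - 1) = real N + k + 1 - c"
    using total by (simp add: sum_subtractf c_def flip: of_nat_sum)
  have "(\<Sum>i\<in>I. 1 / (K - 1) + (real (m i) - 1) * \<sigma>) = c / (K - 1) + (real N + k + 1 - c) * \<sigma>"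
    unfolding sum.distrib sum_distrib_right[symmetric] total' by (simp add: c_def)
  \<comment> \<open>Each part beyond \<open>k + 2\<close> lowers the chord bound by
    \<open>\<sigma> - 1 / (K - 1)\<close>, which is positive.\<close>
  also have "\<dots> = real N / (K - real N) + (real k + 1) / (K - 1) - (real c - k - 2) * (\<sigma> - 1 / (K - 1))"
  proof -
    have "c * x + (real N + k + 1 - c) * \<sigma>
        = (x + (real N - 1) * \<sigma>) + (real k + 1) * x - (real c - k - 2) * (\<sigma> - x)" for x :: real
      by (simp add: algebra_simps)
    from this[of "1 / (K - 1)"] show ?thesis using frac[of N] by (simp add: \<sigma>_def)
  qed
  finally have bound: "(\<Sum>i\<in>I. 1 / (K - 1) + (real (m i) - 1) * \<sigma>)
    = real N / (K - real N) + (real k + 1) / (K - 1) - (real c - k - 2) * (\<sigma> - 1 / (K - 1))" .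
  have gap: "0 \<le> (real c - k - 2) * (\<sigma> - 1 / (K - 1))"
    using \<sigma> \<open>card I \<ge> k + 2\<close> by (intro mult_nonneg_nonneg) (auto simp: c_def)
  have sum_le: "(\<Sum>i\<in>I. m i / (K - m i)) \<le> (\<Sum>i\<in>I. 1 / (K - 1) + (real (m i) - 1) * \<sigma>)"
    by (intro sum_mono le)
  show "(\<Sum>i\<in>I. m i / (K - m i)) \<le> real N / (K - real N) + (real k + 1) / (K - 1)"
    using sum_le bound gap by linarith
  assume eq: "(\<Sum>i\<in>I. m i / (K - m i)) = real N / (K - real N) + (real k + 1) / (K - 1)"
  have "(real c - k - 2) * (\<sigma> - 1 / (K - 1)) = 0" using eq sum_le bound gap by linarith
  then have c: "c = k + 2" using \<sigma> by (auto simp: of_nat_eq_iff[symmetric, where 'a = real])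
  have cases: "m i = 1 \<or> m i = N" if "i \<in> I" for i
  proof (rule ccontr)
    assume "\<not> (m i = 1 \<or> m i = N)"
    then have "1 < m i" "m i < N" using assms(2,3)[OF that] by auto
    then have "(\<Sum>i\<in>I. m i / (K - m i)) < (\<Sum>i\<in>I. 1 / (K - 1) + (real (m i) - 1) * \<sigma>)"
      using strict[OF that] le that \<open>finite I\<close> by (intro sum_strict_mono_ex1) auto
    then show False using eq bound gap by linarith
  qed
  \<comment> \<open>If no part had size \<open>N\<close>, all would be 1 and the total would give
    \<open>N = 1\<close>, so those parts would have size \<open>N\<close> after all.\<close>
  have "\<exists>i\<in>I. m i = N"
  proof (rule ccontr)
    assume no: "\<not> (\<exists>i\<in>I. m i = N)"
    then have "(\<Sum>i\<in>I. m i) = (\<Sum>i\<in>I. 1)" using cases by (intro sum.cong) auto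
    then have "N = 1" using total c by (simp add: c_def)
    moreover have "I \<noteq> {}" using c c_def by auto
    ultimately show False using no cases by blast
  qed
  then obtain i where i: "i \<in> I" "m i = N" by blast
  \<comment> \<open>The other \<open>k + 1\<close> parts sum to \<open>k + 1\<close> and are at
    least 1, so the natural differences \<open>m j - 1\<close> sum to zero.\<close>
  have "(\<Sum>j\<in>I. m j) = m i + (\<Sum>j\<in>I - {i}. m j)" using i \<open>finite I\<close> by (intro sum.remove)
  moreover have "c = Suc (card (I - {i}))"
    unfolding c_def using i \<open>finite I\<close> by (intro card.remove)
  moreover have "(\<Sum>j\<in>I - {i}. m j) = (\<Sum>j\<in>I - {i}. m j - 1) + (\<Sum>j\<in>I - {i}. 1)"
    unfolding sum.distrib[symmetric] using assms(2) by (intro sum.cong) force+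
  ultimately have "(\<Sum>j\<in>I - {i}. m j - 1) = 0" using total c i by simp
  then have "\<forall>j\<in>I - {i}. m j - 1 = 0" using \<open>finite I\<close> by simp
  then have "\<forall>j\<in>I - {i}. m j = 1" using assms(2) by (metis DiffD1 diff_is_0_eq' le_antisym diff_is_0_eq)
  with i show "\<exists>i\<in>I. m i = N \<and> (\<forall>j\<in>I - {i}. m j = 1)" by blast
qed

text \<open>Solving the rows of the clique and of the pendant vertices for their entries and
  substituting into the row of the hub gives this equation for \<open>K\<close>, where the
  eigenvalue is \<open>K - 1 + \<alpha>\<close>. A root comes from the intermediate value
  theorem.\<close>

lemma ext_graph_radius_equation:
  fixes \<alpha> :: real and N k :: nat
  assumes "0 < \<alpha>" "\<alpha> < 1" "N \<ge> 1"
  obtains K :: real where "K > real N + 1 - \<alpha>"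
    "\<alpha> * (real N + real k + 1) + (1 - \<alpha>)\<^sup>2 * (real N / (K - real N) + (real k + 1) / (K - 1)) = K - 1 + \<alpha>"
proof -
  define F where "F K = \<alpha> * (real N + real k + 1) + (1 - \<alpha>)\<^sup>2 * (real N / (K - real N) + (real k + 1) / (K - 1)) - (K - 1 + \<alpha>)" for K :: real
  \<comment> \<open>\<open>a\<close> corresponds to the eigenvalue \<open>N\<close> of the clique
    formed with the hub, \<open>b\<close> to the maximum degree \<open>N + k + 1\<close>. Strict
    positivity at \<open>a\<close> yields the strict lower bound on \<open>K\<close>.\<close>
  define a b where "a = real N + 1 - \<alpha>" and "b = real N + k + 2 - \<alpha>"
  have N: "real N \<ge> 1" using assms by simp
  have "a \<le> b" by (simp add: a_def b_def)
  have cont: "continuous_on {a..b} F"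
    unfolding F_def using assms N by (intro continuous_intros) (auto simp: a_def)
  have Fa: "F a > 0"
  proof -
    have "(1 - \<alpha>)\<^sup>2 * (real N / (a - real N)) = (1 - \<alpha>) * N"
      using assms by (simp add: a_def power2_eq_square)
    then have "F a = \<alpha> * (real k + 1) + (1 - \<alpha>)\<^sup>2 * ((real k + 1) / (a - 1))"
      by (simp add: F_def distrib_left a_def algebra_simps)
    moreover have "\<alpha> * (real k + 1) > 0" using assms by simp
    moreover have "(1 - \<alpha>)\<^sup>2 * ((real k + 1) / (a - 1)) \<ge> 0"
      using assms N by (intro mult_nonneg_nonneg divide_nonneg_nonneg) (auto simp: a_def)
    ultimately show ?thesis by linarith
  qed
  have Fb: "F b \<le> 0"
  proof -
    have "real N / (b - real N) + (real k + 1) / (b - 1) \<le> real N / (1 - \<alpha>) + (real k + 1) / (1 - \<alpha>)"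
      using assms N by (intro add_mono divide_left_mono mult_pos_pos) (auto simp: b_def)
    then have "(1 - \<alpha>)\<^sup>2 * (real N / (b - real N) + (real k + 1) / (b - 1))
        \<le> (1 - \<alpha>)\<^sup>2 * (real N / (1 - \<alpha>) + (real k + 1) / (1 - \<alpha>))"
      by (intro mult_left_mono) auto
    also have "\<dots> = (1 - \<alpha>) * (real N + real k + 1)"
      using assms by (simp add: power2_eq_square flip: add_divide_distrib)
    finally show ?thesis by (simp add: F_def b_def algebra_simps)
  qed
  obtain K where K: "a \<le> K" "K \<le> b" "F K = 0"
    using IVT2'[of F b 0 a] Fa Fb \<open>a \<le> b\<close> cont by auto
  have "K \<noteq> a" using K Fa by auto
  then show ?thesis using that[of K] K by (simp add: a_def F_def)
qed

text \<open>The eigenvector is 1 at the hub and \<open>(1 - \<alpha>) / (K - m)\<close> on a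
  component of size \<open>m\<close> of the rest. Rows away from the hub hold by the choice of these
  values, the row of the hub is \<open>root\<close>.\<close>

lemma ext_graph_eigenvalue:
  fixes \<alpha> K :: real and N k :: nat
  assumes "N \<ge> 1" "real N < K"
    and root: "\<alpha> * (real N + real k + 1) + (1 - \<alpha>)\<^sup>2 * (real N / (K - real N) + (real k + 1) / (K - 1)) = K - 1 + \<alpha>"
  defines "n \<equiv> N + k + 2"
  shows "is_eigenvalue_on {0..<n} (A_alpha \<alpha> {0..<n} (ext_graph_edges n k)) (K - 1 + \<alpha>)"
proof -
  define E where "E = ext_graph_edges n k"
  define t where "t m = (1 - \<alpha>) / (K - real m)" for m :: nat
  define y where "y v = (if v = 0 then 1 else if v \<le> N then t N else t 1)" for v :: nat
  have K1: "K > 1" using assms by linarith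
  have t: "t m * (K - real m) = 1 - \<alpha>" if "m = N \<or> m = 1" for m
    using that K1 assms(2) by (auto simp: t_def)
  have row: "(\<Sum>w = 0..<n. A_alpha \<alpha> {0..<n} E v w * y w) = (K - 1 + \<alpha>) * y v" if v: "v < n" for v
  proof -
    have r: "(\<Sum>w = 0..<n. A_alpha \<alpha> {0..<n} E v w * y w)
      = \<alpha> * card {w \<in> {0..<n}. E v w} * y v + (1 - \<alpha>) * (\<Sum>w | w \<in> {0..<n} \<and> E v w. y w)"
      using A_alpha_row[of "{0..<n}" v] v by (simp add: degree_def)
    consider "v = 0" | "1 \<le> v" "v \<le> N" | "N < v" by linarith
    then show ?thesis
    proof cases
      case 1
      have nb: "{w \<in> {0..<n}. E v w} = {1..N} \<union> {N + 1..<n}"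
        using 1 \<open>N \<ge> 1\<close> by (auto simp: E_def ext_graph_edges_def n_def)
      have "(\<Sum>w\<in>{1..N}. y w) = (\<Sum>w\<in>{1..N}. t N)" by (intro sum.cong) (auto simp: y_def)
      moreover have "(\<Sum>w\<in>{N + 1..<n}. y w) = (\<Sum>w\<in>{N + 1..<n}. t 1)"
        by (intro sum.cong) (auto simp: y_def)
      moreover have "(\<Sum>w\<in>{1..N} \<union> {N + 1..<n}. y w) = (\<Sum>w\<in>{1..N}. y w) + (\<Sum>w\<in>{N + 1..<n}. y w)"
        by (intro sum.union_disjoint) auto
      ultimately have "(\<Sum>w\<in>{1..N} \<union> {N + 1..<n}. y w) = N * t N + (real k + 1) * t 1"
        by (simp add: n_def)
      moreover have "card ({1..N} \<union> {N + 1..<n}) = N + k + 1"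
        by (subst card_Un_disjoint) (auto simp: n_def)
      moreover have "(1 - \<alpha>) * (N * t N + (real k + 1) * t 1) = (1 - \<alpha>)\<^sup>2 * (real N / (K - real N) + (real k + 1) / (K - 1))"
      proof -
        have "a * (x * (a / b) + z * (a / c)) = a\<^sup>2 * (x / b + z / c)" for a b c x z :: real
          by (simp add: power2_eq_square algebra_simps)
        from this[of "1 - \<alpha>"] show ?thesis by (simp add: t_def)
      qed
      ultimately show ?thesis using r root 1 unfolding nb by (simp add: y_def add_ac)
    next
      case 2
      have nb: "{w \<in> {0..<n}. E v w} = insert 0 ({1..N} - {v})"
        using 2 by (auto simp: E_def ext_graph_edges_def n_def)
      have "(\<Sum>w\<in>{1..N} - {v}. y w) = (\<Sum>w\<in>{1..N} - {v}. t N)"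
        by (intro sum.cong) (auto simp: y_def)
      then have "(\<Sum>w\<in>insert 0 ({1..N} - {v}). y w) = 1 + (real N - 1) * t N"
        using 2 by (simp add: y_def of_nat_diff)
      moreover have "card (insert 0 ({1..N} - {v})) = N" using 2 by simp
      ultimately show ?thesis using r 2 t[of N] unfolding nb by (simp add: y_def algebra_simps)
    next
      case 3
      have nb: "{w \<in> {0..<n}. E v w} = {0}"
        using 3 v \<open>N \<ge> 1\<close> by (auto simp: E_def ext_graph_edges_def n_def)
      show ?thesis using r 3 t[of 1] unfolding nb by (simp add: y_def algebra_simps)
    qed
  qed
  have "\<exists>v\<in>{0..<n}. y v \<noteq> 0" by (rule bexI[of _ 0]) (auto simp: y_def n_def)
  with row show ?thesis
    unfolding is_eigenvalue_on_def E_def[symmetric] by (intro exI[of _ y]) auto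
qed

text \<open>Adjacency of distinct vertices depends only on their classes \<open>{w}\<close>,
  \<open>X\<close> and the rest, so any bijection matching these classes with \<open>{0}\<close>,
  \<open>{1..N}\<close> and the remaining numbers is an isomorphism.\<close>

lemma graph_iso_ext_graph:
  assumes "card V = N + k + 2" "finite V" "w \<in> V" "X \<subseteq> V - {w}" "card X = N"
    and adj: "\<And>u v. u \<in> V \<Longrightarrow> v \<in> V \<Longrightarrow>
      E u v \<longleftrightarrow> u \<noteq> v \<and> (u = w \<or> v = w \<or> u \<in> X \<and> v \<in> X)"
  shows "graph_iso V E {0..<N + k + 2} (ext_graph_edges (N + k + 2) k)"
proof -
  define R where "R = V - {w} - X"
  have fin: "finite X" "finite R" using assms finite_subset[of X V] by (auto simp: R_def)
  have "card R = k + 1"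
    using assms fin by (simp add: R_def card_Diff_subset)
  obtain g where g: "bij_betw g X {1..N}"
    using finite_same_card_bij[of X "{1..N}"] fin assms by auto
  obtain h where h: "bij_betw h R {N + 1..<N + k + 2}"
    using finite_same_card_bij[of R "{N + 1..<N + k + 2}"] fin \<open>card R = k + 1\<close> by auto
  define f where "f x = (if x \<in> {w} then 0 else if x \<in> X then g x else h x)" for x
  have gh: "bij_betw (\<lambda>x. if x \<in> X then g x else h x) (X \<union> R) ({1..N} \<union> {N + 1..<N + k + 2})"
    by (rule bij_betw_disjoint_Un[OF g h]) (auto simp: R_def)
  have "bij_betw f ({w} \<union> (X \<union> R)) ({0} \<union> ({1..N} \<union> {N + 1..<N + k + 2}))"
    unfolding f_def by (rule bij_betw_disjoint_Un[OF _ gh]) (use assms(4) in \<open>auto simp: R_def bij_betw_def\<close>)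
  moreover have "{w} \<union> (X \<union> R) = V" using assms by (auto simp: R_def)
  moreover have "{0} \<union> ({1..N} \<union> {N + 1..<N + k + 2}) = {0..<N + k + 2}" by auto
  ultimately have f: "bij_betw f V {0..<N + k + 2}" by simp
  have fX: "1 \<le> f x \<and> f x \<le> N" if "x \<in> X" for x
    using that g assms(4) by (auto simp: f_def bij_betw_def)
  have fR: "N < f x" if "x \<in> V" "x \<noteq> w" "x \<notin> X" for x
    using that bij_betwE[OF h] by (auto simp: f_def R_def Ball_def)
  have "E u v \<longleftrightarrow> ext_graph_edges (N + k + 2) k (f u) (f v)" if "u \<in> V" "v \<in> V" for u v
  proof -
    have *: "f x = 0 \<longleftrightarrow> x = w" "1 \<le> f x \<and> f x \<le> N \<longleftrightarrow> x \<in> X" if "x \<in> V" for x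
      using fX[of x] fR[of x] that assms(4) by (auto simp: f_def split: if_splits)
    have "f u = f v \<longleftrightarrow> u = v" "f u < N + k + 2" "f v < N + k + 2"
      using f that by (auto simp: bij_betw_def inj_on_def)
    then show ?thesis
      using adj[OF that] *[OF that(1)] *[OF that(2)] by (auto simp: ext_graph_edges_def)
  qed
  with f show ?thesis unfolding graph_iso_def by blast
qed

section \<open>Cut vertices\<close>

text \<open>The vector \<open>y\<close> solves the rows away from \<open>w\<close> exactly for the
  graph in which every component is completed to a clique and joined to \<open>w\<close>. Missing
  edges only lower a row, so tightness rules them out, and tightness at \<open>w\<close> fixes the
  component sizes.\<close>

lemma cut_vertex_graph_iso:
  fixes \<alpha> K r :: real
  assumes G: "simple_graph V E" "connected_graph V E" and n: "card V = N + k + 2"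
    and "N \<ge> 1" "w \<in> V" and comps: "num_components (V - {w}) E \<ge> k + 2"
    and \<alpha>: "0 < \<alpha>" "\<alpha> < 1" and K: "real N < K"
    and root: "\<alpha> * (real N + real k + 1) + (1 - \<alpha>)\<^sup>2 * (real N / (K - real N) + (real k + 1) / (K - 1)) = K - 1 + \<alpha>"
    and r: "is_eigenvalue_on V (A_alpha \<alpha> V E) r" "K - 1 + \<alpha> \<le> r"
  shows "graph_iso V E {0..<N + k + 2} (ext_graph_edges (N + k + 2) k)"
proof -
  define W where "W = V - {w}"
  define C where "C = component_in W E"
  define t where "t m = (1 - \<alpha>) / (K - real m)" for m :: nat
  define y where "y v = (if v = w then 1 else t (card (C v)))" for v
  define nb where "nb v = {u \<in> V. E v u}" for v
  \<comment> \<open>\<open>U v\<close> is the largest neighbourhood that \<open>v\<close> can have;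
    trading \<open>v\<close> for \<open>w\<close> keeps its size equal to that of
    \<open>C v\<close>.\<close>
  define U where "U v = insert w (C v - {v})" for v
  have fin: "finite V" "finite W" using G by (auto simp: simple_graph_def W_def)
  have finC: "finite (C v)" for v using finite_subset[OF component_in_subset] fin(2) by (auto simp: C_def)
  have cardW: "card W = N + k + 1" using n fin \<open>w \<in> V\<close> by (simp add: W_def)
  have K1: "K > 1" using K \<open>N \<ge> 1\<close> by linarith
  \<comment> \<open>At least \<open>k + 2\<close> components share \<open>N + k + 1\<close>
    vertices, so none exceeds \<open>N\<close>. This keeps \<open>K - m\<close> positive.\<close>
  have sizes: "1 \<le> card X" "card X \<le> N" if "X \<in> C ` W" for X
    using component_size_pos[OF fin(2), of X E] component_size_le[OF G(1) fin(2), of X] that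
      comps cardW by (auto simp: C_def W_def)
  have tpos: "t m > 0" if "m \<le> N" for m using that K \<alpha> by (simp add: t_def)
  have teq: "t m * (K - real m) = 1 - \<alpha>" if "m \<le> N" for m using that K by (simp add: t_def)
  have ypos: "y v > 0" if "v \<in> V" for v
    using that tpos sizes[of "C v"] by (auto simp: y_def W_def)
  have row: "(\<Sum>u\<in>V. A_alpha \<alpha> V E v u * y u) = \<alpha> * card (nb v) * y v + (1 - \<alpha>) * sum y (nb v)"
    if "v \<in> V" for v
    using A_alpha_row[OF fin(1) that] by (simp add: degree_def nb_def)
  have nb_subset: "nb v \<subseteq> U v" if "v \<in> W" for v
    using that neighbour_in_component[of v W _ E] G(1)
    by (auto simp: nb_def U_def C_def W_def simple_graph_def)
  have CW: "C v \<subseteq> W" for v unfolding C_def by (rule component_in_subset)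
  have vC: "v \<in> C v" if "v \<in> W" for v using self_in_component that by (auto simp: C_def)
  have cardU: "card (U v) = card (C v)" and finU: "finite (U v)" and UV: "U v \<subseteq> V" if "v \<in> W" for v
    using vC[OF that] CW[of v] finC[of v] \<open>w \<in> V\<close> sizes[of "C v"] that
    by (auto simp: U_def W_def card_insert_if)
  have sumU: "\<alpha> * card (U v) * y v + (1 - \<alpha>) * sum y (U v) = (K - 1 + \<alpha>) * y v" if v: "v \<in> W" for v
  proof -
    define m where "m = card (C v)"
    have m: "1 \<le> m" "m \<le> N" using sizes v by (auto simp: m_def)
    have yC: "y u = t m" if "u \<in> C v" for u
      using component_in_eq[OF G(1), of u W v] that CW[of v] by (auto simp: y_def m_def C_def W_def)
    have "sum y (C v - {v}) = (\<Sum>u\<in>C v - {v}. t m)" by (intro sum.cong) (auto simp: yC)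
    also have "\<dots> = (real m - 1) * t m" using vC[OF v] finC m by (simp add: m_def of_nat_diff)
    finally have "sum y (U v) = 1 + (real m - 1) * t m"
      unfolding U_def using CW[of v] finC by (subst sum.insert) (auto simp: W_def y_def)
    moreover have "\<alpha> * m * t m + (1 - \<alpha>) * (1 + (real m - 1) * t m) = (K - 1 + \<alpha>) * t m"
      using teq[OF m(2)] by (simp add: algebra_simps)
    ultimately show ?thesis using cardU[OF v] yC[OF vC[OF v]] by (simp add: m_def)
  qed
  have row_W: "(\<Sum>u\<in>V. A_alpha \<alpha> V E v u * y u) \<le> (K - 1 + \<alpha>) * y v"
    and row_W_strict: "nb v \<noteq> U v \<Longrightarrow> (\<Sum>u\<in>V. A_alpha \<alpha> V E v u * y u) < (K - 1 + \<alpha>) * y v"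
    if v: "v \<in> W" for v
  proof -
    have vV: "v \<in> V" using v by (simp add: W_def)
    have nonneg: "0 \<le> y u" if "u \<in> U v" for u using ypos UV[OF v] that by fastforce
    have 1: "\<alpha> * card (nb v) * y v \<le> \<alpha> * card (U v) * y v"
      using card_mono[OF finU nb_subset] v \<alpha> ypos[OF vV]
      by (intro mult_right_mono mult_left_mono) auto
    have "sum y (nb v) \<le> sum y (U v)"
      using nb_subset[OF v] finU[OF v] nonneg by (intro sum_mono2) auto
    then have "(1 - \<alpha>) * sum y (nb v) \<le> (1 - \<alpha>) * sum y (U v)" using \<alpha> by simp
    then show "(\<Sum>u\<in>V. A_alpha \<alpha> V E v u * y u) \<le> (K - 1 + \<alpha>) * y v"
      using 1 row[OF vV] sumU[OF v] by linarith
    assume "nb v \<noteq> U v"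
    then obtain b where b: "b \<in> U v - nb v" using nb_subset[OF v] by blast
    have "sum y (nb v) < sum y (U v)"
      using nb_subset[OF v] finU[OF v] nonneg b ypos[of b] UV[OF v] by (intro sum_strict_mono2[of _ _ b]) auto
    then have "(1 - \<alpha>) * sum y (nb v) < (1 - \<alpha>) * sum y (U v)" using \<alpha> by simp
    then show "(\<Sum>u\<in>V. A_alpha \<alpha> V E v u * y u) < (K - 1 + \<alpha>) * y v"
      using 1 row[OF vV] sumU[OF v] by linarith
  qed
  have total: "(\<Sum>X\<in>C ` W. card X) = N + k + 1"
    using sum_component_sizes[OF G(1) fin(2)] cardW by (simp add: C_def)
  have cardP: "card (C ` W) \<ge> k + 2" using comps by (simp add: num_components_eq C_def W_def)
  have frac_le: "(\<Sum>X\<in>C ` W. card X / (K - card X)) \<le> real N / (K - real N) + (real k + 1) / (K - 1)"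
    by (rule fraction_sum(1)[OF finite_imageI[OF fin(2)] sizes total cardP K \<open>N \<ge> 1\<close>])
  have sumW: "sum y W = (1 - \<alpha>) * (\<Sum>X\<in>C ` W. card X / (K - card X))"
  proof -
    have "sum y W = (\<Sum>v\<in>W. t (card (C v)))" by (intro sum.cong) (auto simp: y_def W_def)
    also have "\<dots> = (\<Sum>X\<in>C ` W. real (card X) * t (card X))"
      unfolding C_def by (rule sum_over_components[OF G(1) fin(2)])
    finally show ?thesis by (simp add: t_def sum_distrib_left mult.commute)
  qed
  have nbw: "nb w \<subseteq> W" using G(1) by (auto simp: nb_def W_def simple_graph_def)
  have row_w: "(\<Sum>u\<in>V. A_alpha \<alpha> V E w u * y u)
      \<le> \<alpha> * (real N + real k + 1) + (1 - \<alpha>)\<^sup>2 * (\<Sum>X\<in>C ` W. card X / (K - card X))"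
  proof -
    have "real (card (nb w)) \<le> real N + real k + 1" using card_mono[OF fin(2) nbw] cardW by linarith
    then have "\<alpha> * card (nb w) \<le> \<alpha> * (real N + real k + 1)" using \<alpha> by (intro mult_left_mono) auto
    moreover have "sum y (nb w) \<le> sum y W"
      using nbw fin(2) ypos by (intro sum_mono2) (auto simp: W_def less_imp_le)
    then have "(1 - \<alpha>) * sum y (nb w) \<le> (1 - \<alpha>) * sum y W" using \<alpha> by simp
    ultimately show ?thesis using row[OF \<open>w \<in> V\<close>] sumW
      by (simp add: y_def power2_eq_square mult.assoc)
  qed
  have "(1 - \<alpha>)\<^sup>2 * (\<Sum>X\<in>C ` W. card X / (K - card X)) \<le> (1 - \<alpha>)\<^sup>2 * (real N / (K - real N) + (real k + 1) / (K - 1))"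
    using frac_le by (rule mult_left_mono) simp
  then have "(\<Sum>u\<in>V. A_alpha \<alpha> V E w u * y u) \<le> (K - 1 + \<alpha>) * y w"
    using row_w root by (simp add: y_def)
  then have rows: "(\<Sum>u\<in>V. A_alpha \<alpha> V E v u * y u) \<le> (K - 1 + \<alpha>) * y v" if "v \<in> V" for v
    using row_W[of v] that by (cases "v = w") (auto simp: W_def)
  \<comment> \<open>All rows are bounded by \<open>K - 1 + \<alpha>\<close>, which is at most the
    eigenvalue \<open>r\<close>, and the graph is connected.\<close>
  have tight: "(\<Sum>u\<in>V. A_alpha \<alpha> V E v u * y u) = (K - 1 + \<alpha>) * y v" if "v \<in> V" for v
  proof (rule superharmonic_rows_tight[OF fin(1) ypos _ rows r])
    show "A_alpha \<alpha> V E u v > 0" if "E u v" for u v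
      using that \<alpha> by (auto simp: A_alpha_def intro!: add_nonneg_pos)
  qed (use \<alpha> connected_graph_reach[OF G] that in \<open>auto simp: A_alpha_def\<close>)
  have nbU: "nb v = U v" if "v \<in> W" for v
    using row_W_strict[OF that] tight[of v] that by (force simp: W_def)
  \<comment> \<open>Tightness at \<open>w\<close> makes the fraction sum attain its maximum, so one
    component has size \<open>N\<close> and the others are single vertices.\<close>
  have "(1 - \<alpha>)\<^sup>2 * (real N / (K - real N) + (real k + 1) / (K - 1)) \<le> (1 - \<alpha>)\<^sup>2 * (\<Sum>X\<in>C ` W. card X / (K - card X))"
    using row_w root tight[OF \<open>w \<in> V\<close>] by (simp add: y_def)
  then have "real N / (K - real N) + (real k + 1) / (K - 1) \<le> (\<Sum>X\<in>C ` W. card X / (K - card X))"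
    using \<alpha> by (subst (asm) mult_le_cancel_left_pos) auto
  then have "(\<Sum>X\<in>C ` W. card X / (K - card X)) = real N / (K - real N) + (real k + 1) / (K - 1)"
    using frac_le by linarith
  from fraction_sum(2)[OF finite_imageI[OF fin(2)] sizes total cardP K \<open>N \<ge> 1\<close> this]
  obtain X where X: "X \<in> C ` W" "card X = N" "\<forall>Y\<in>C ` W - {X}. card Y = 1"
    by blast
  have inX: "C v = X" if "v \<in> X" for v
    using X(1) component_in_eq[OF G(1), of v W] that by (auto simp: C_def)
  have notX: "C v = {v}" if "v \<in> W" "v \<notin> X" for v
  proof -
    have "card (C v) = 1" using X(3) that vC[OF that(1)] by auto
    then show ?thesis using vC[OF that(1)] by (metis card_1_singletonE singletonD)
  qed
  have XW: "X \<subseteq> W" using X(1) CW by auto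
  have adjW: "E v u \<longleftrightarrow> u \<noteq> v \<and> (u = w \<or> v \<in> X \<and> u \<in> X)" if "v \<in> W" "u \<in> V" for u v
  proof -
    have "E v u \<longleftrightarrow> u \<in> U v" using nbU[OF that(1)] that(2) by (auto simp: nb_def)
    then show ?thesis
      using that inX[of v] notX[of v] by (cases "v \<in> X") (auto simp: U_def W_def)
  qed
  have symE: "E u v \<longleftrightarrow> E v u" for u v using G(1) by (auto simp: simple_graph_def)
  show ?thesis
  proof (rule graph_iso_ext_graph[OF n fin(1) \<open>w \<in> V\<close> _ X(2)])
    show "X \<subseteq> V - {w}" using XW by (simp add: W_def)
    fix u v assume uv: "u \<in> V" "v \<in> V"
    show "E u v \<longleftrightarrow> u \<noteq> v \<and> (u = w \<or> v = w \<or> u \<in> X \<and> v \<in> X)"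
    proof (cases "u = w")
      case False
      then show ?thesis using adjW[of u v] uv by (auto simp: W_def)
    next
      case True
      have "\<not> E w w" using G(1) by (auto simp: simple_graph_def)
      then show ?thesis using adjW[of v u] uv True symE[of u v] by (auto simp: W_def)
    qed
  qed
qed

section \<open>Larger cuts\<close>

text \<open>Here \<open>d\<close> is a vertex degree, \<open>Q\<close> the degree sum of its
  neighbours, \<open>p\<close> the order minus one. For \<open>d \<le> d0\<close> the bound
  \<open>Q \<le> d * p\<close> suffices, with \<open>\<alpha> \<ge> 1/2\<close> giving the sign of
  the remainder; otherwise \<open>Q \<le> d0 * p\<close> does.\<close>

lemma degree_row_bound:
  fixes d d0 p \<alpha> Q :: real
  assumes "1/2 \<le> \<alpha>" "\<alpha> \<le> 1" "0 < d" "d \<le> p" "d0 \<le> p" "Q \<le> d * p" "Q \<le> d0 * p"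
  shows "\<alpha> * d * d + (1 - \<alpha>) * Q \<le> (\<alpha> * p + (1 - \<alpha>) * d0) * d"
proof (cases "d \<le> d0")
  case True
  have "(1 - \<alpha>) * Q \<le> (1 - \<alpha>) * (d * p)" using assms by (intro mult_left_mono) auto
  moreover have "\<alpha> * d * d \<le> \<alpha> * d0 * d" using assms True by (intro mult_right_mono mult_left_mono) auto
  moreover have "0 \<le> (2 * \<alpha> - 1) * (p - d0) * d" using assms by (intro mult_nonneg_nonneg) auto
  ultimately show ?thesis by (simp add: algebra_simps)
next
  case False
  have "(1 - \<alpha>) * Q \<le> (1 - \<alpha>) * (d0 * p)" using assms by (intro mult_left_mono) auto
  moreover have "(1 - \<alpha>) * d0 \<le> \<alpha> * d"
  proof (cases "d0 \<ge> 0")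
    case True
    then show ?thesis using assms False by (intro mult_mono) auto
  next
    case False
    then have "(1 - \<alpha>) * d0 \<le> 0" using assms by (intro mult_nonneg_nonpos) auto
    also have "0 \<le> \<alpha> * d" using assms by simp
    finally show ?thesis .
  qed
  then have "0 \<le> (p - d) * (\<alpha> * d - (1 - \<alpha>) * d0)" using assms by (intro mult_nonneg_nonneg) auto
  ultimately show ?thesis by (simp add: algebra_simps)
qed

lemma degree_less_card:
  assumes "simple_graph V E" "v \<in> V"
  shows "Defs.degree V E v + 1 \<le> card V"
proof -
  have "{u \<in> V. E v u} \<subset> V" using assms by (auto simp: simple_graph_def)
  then have "card {u \<in> V. E v u} < card V" using assms by (intro psubset_card_mono) (auto simp: simple_graph_def)
  then show ?thesis by (simp add: degree_def)
qed

lemma connected_degree_pos: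
  assumes "simple_graph V E" "connected_graph V E" "card V \<ge> 2" "v \<in> V"
  shows "Defs.degree V E v \<ge> 1"
proof -
  have "V \<noteq> {v}" using assms by auto
  then obtain u where u: "u \<in> V" "u \<noteq> v" using assms by blast
  have "reach_in V E v u" using connected_graph_reach assms u by metis
  then obtain z where "E v z" "z \<in> V"
    unfolding reach_in_def using u(2) by (auto elim: converse_rtranclpE)
  then have "z \<in> {u \<in> V. E v u}" by simp
  moreover have "finite {u \<in> V. E v u}" using assms by (simp add: simple_graph_def)
  ultimately show ?thesis unfolding degree_def by (metis One_nat_def Suc_leI card_gt_0_iff empty_iff)
qed

text \<open>The degree vector serves as the positive comparison vector; connectedness makes all its
  entries at least 1.\<close>

lemma eigenvalue_le_degree_sum:
  fixes \<alpha> r :: real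
  assumes G: "simple_graph V E" "connected_graph V E" and "card V \<ge> 2"
    and \<alpha>: "1/2 \<le> \<alpha>" "\<alpha> \<le> 1" and r: "is_eigenvalue_on V (A_alpha \<alpha> V E) r"
  shows "r \<le> \<alpha> * (real (card V) - 1)
    + (1 - \<alpha>) * ((\<Sum>v\<in>V. real (Defs.degree V E v)) / (real (card V) - 1) - 1)"
proof -
  define d where "d v = real (Defs.degree V E v)" for v
  define p where "p = real (card V) - 1"
  define d0 where "d0 = sum d V / p - 1"
  have fin: "finite V" using G by (simp add: simple_graph_def)
  have p: "p > 0" using \<open>card V \<ge> 2\<close> by (simp add: p_def)
  have dle: "d v \<le> p" if "v \<in> V" for v
    using degree_less_card[OF G(1) that] by (simp add: d_def p_def)
  have dge: "d v \<ge> 1" if "v \<in> V" for v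
    using connected_degree_pos[OF G \<open>card V \<ge> 2\<close> that] by (simp add: d_def)
  have "sum d V \<le> card V * p" using sum_bounded_above[of V d p] dle by simp
  then have d0: "d0 \<le> p" using p by (simp add: d0_def p_def field_simps)
  have d0p: "d0 * p = sum d V - p" using p by (simp add: d0_def field_simps)
  have "r \<le> \<alpha> * p + (1 - \<alpha>) * d0"
  proof (rule eigenvalue_le_of_superharmonic[OF fin _ _ _ r])
    show "0 < d v" if "v \<in> V" for v using dge[OF that] by simp
    show "0 \<le> A_alpha \<alpha> V E u v" for u v using \<alpha> by (simp add: A_alpha_def)
    fix u assume u: "u \<in> V"
    define nb where "nb = {v \<in> V. E u v}"
    have nb: "nb \<subseteq> V - {u}" "finite nb" using G fin by (auto simp: nb_def simple_graph_def)
    have du: "d u = card nb" by (simp add: d_def degree_def nb_def)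
    have Q1: "sum d nb \<le> d u * p" using sum_bounded_above[of nb d p] dle nb by (auto simp: du)
    \<comment> \<open>Each of the \<open>p - d u\<close> non-neighbours of \<open>u\<close> has
      degree at least 1. Together with \<open>d u\<close> they account for at least \<open>p\<close>
      of the total, leaving at most \<open>d0 * p\<close> for the neighbours.\<close>
    have "sum d V = d u + sum d (V - {u})" using fin u by (intro sum.remove)
    also have "sum d (V - {u}) = sum d (V - {u} - nb) + sum d nb"
      using nb fin by (intro sum.subset_diff) auto
    finally have "sum d V = d u + sum d (V - {u} - nb) + sum d nb" by simp
    moreover have "real (card (V - {u} - nb)) \<le> sum d (V - {u} - nb)"
      using sum_bounded_below[of "V - {u} - nb" 1 d] dge by simp
    moreover have "real (card (V - {u} - nb)) = p - d u"
      using nb u fin degree_less_card[OF G(1) u]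
      by (simp add: card_Diff_subset du p_def of_nat_diff degree_def flip: nb_def)
    ultimately have Q2: "sum d nb \<le> d0 * p" unfolding d0p by linarith
    show "(\<Sum>v\<in>V. A_alpha \<alpha> V E u v * d v) \<le> (\<alpha> * p + (1 - \<alpha>) * d0) * d u"
      unfolding A_alpha_row[OF fin u]
      using degree_row_bound[OF \<alpha> _ dle[OF u] d0 Q1 Q2] dge[OF u] by (simp add: d_def nb_def)
  qed
  then show ?thesis by (simp add: p_def d0_def d_def)
qed

text \<open>The bound is the degree sum of the join of a clique on \<open>s\<close> vertices with
  one clique and \<open>k * s + 1\<close> isolated vertices. The sum of squared component sizes is
  largest when all components but one are single vertices.\<close>

lemma degree_sum_le:
  assumes G: "simple_graph V E" and S: "S \<subseteq> V" and comps: "num_components (V - S) E \<ge> k * card S + 2"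
  defines "n \<equiv> real (card V)" and "s \<equiv> real (card S)"
  shows "(\<Sum>v\<in>V. real (Defs.degree V E v)) \<le> (n - k * s - 1) * (n - k * s - 2) + 2 * s * (k * s + 1)"
    and "card S + k * card S + 2 \<le> card V"
proof -
  define W where "W = V - S"
  define C where "C = component_in W E"
  define d where "d v = real (Defs.degree V E v)" for v
  have fin: "finite V" "finite S" "finite W"
    using G S finite_subset by (auto simp: W_def simple_graph_def)
  have cardW: "real (card W) = n - s" "card W + card S = card V"
    using card_Diff_subset[OF fin(2) S] card_mono[OF fin(1) S] by (auto simp: W_def n_def s_def)
  \<comment> \<open>\<open>M\<close> is the largest size a component can have: all others being
    single vertices, at least \<open>k * s + 1\<close> of them are removed.\<close>
  define M where "M = n - s - (k * s + 1)"
  have sizes: "1 \<le> card X" "real (card X) \<le> M" if "X \<in> C ` W" for X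
  proof -
    show "1 \<le> card X" using component_size_pos[OF fin(3)] that by (simp add: C_def)
    have "card X + num_components W E \<le> card W + 1"
      using component_size_le[OF G fin(3)] that by (simp add: C_def)
    then have "card X + k * card S + 1 \<le> card W" using comps by (simp add: W_def)
    then have "real (card X + k * card S + 1) \<le> real (card W)" by (simp only: of_nat_le_iff)
    then show "real (card X) \<le> M" by (simp add: M_def cardW s_def)
  qed
  have total: "(\<Sum>X\<in>C ` W. real (card X)) = n - s"
    using sum_component_sizes[OF G fin(3)] cardW by (simp add: C_def flip: of_nat_sum)
  have "card (C ` W) \<ge> 2" using comps by (simp add: num_components_eq C_def W_def)
  then have "C ` W \<noteq> {}" by force
  then have M1: "M \<ge> 1" using sizes by fastforce
  then have "real (card S + k * card S + 2) \<le> real (card V)" by (simp add: M_def n_def s_def)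
  then show "card S + k * card S + 2 \<le> card V" by (simp only: of_nat_le_iff)
  have dS: "d v \<le> n - 1" if "v \<in> S" for v
    using degree_less_card[OF G, of v] S that by (auto simp: d_def n_def)
  have dW: "d v \<le> (s - 1) + card (C v)" if v: "v \<in> W" for v
  proof -
    have finC: "finite (C v)" using finite_subset[OF component_in_subset] fin(3) by (auto simp: C_def)
    have vC: "v \<in> C v" using self_in_component[OF v] by (simp add: C_def)
    have "{u \<in> V. E v u} \<subseteq> S \<union> (C v - {v})"
      using v neighbour_in_component[of v W _ E] G by (auto simp: W_def C_def simple_graph_def)
    then have "Defs.degree V E v \<le> card (S \<union> (C v - {v}))"
      unfolding degree_def using fin finC by (intro card_mono) auto
    also have "\<dots> \<le> card S + card (C v - {v})" by (rule card_Un_le)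
    also have "card (C v - {v}) = card (C v) - 1" using vC by simp
    finally have "Defs.degree V E v \<le> card S + (card (C v) - 1)" .
    moreover have "1 \<le> card (C v)" using sizes v by auto
    ultimately show ?thesis by (simp add: d_def s_def)
  qed
  \<comment> \<open>On sizes between 1 and \<open>M\<close>, the square lies below a linear function
    of the size, whose sum involves only the total and the number of components.\<close>
  have "(\<Sum>X\<in>C ` W. real (card X) * card X) \<le> (\<Sum>X\<in>C ` W. real (card X) + (real (card X) - 1) * M)"
  proof (rule sum_mono)
    fix X assume X: "X \<in> C ` W"
    have "(real (card X) - 1) * card X \<le> (real (card X) - 1) * M"
      using sizes[OF X] by (intro mult_left_mono) auto
    then show "real (card X) * card X \<le> real (card X) + (real (card X) - 1) * M"
      by (simp add: algebra_simps)
  qed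
  also have "\<dots> = (n - s) + (n - s - card (C ` W)) * M"
    by (simp add: sum.distrib sum_subtractf total flip: sum_distrib_right)
  also have "\<dots> \<le> (n - s) + (M - 1) * M"
  proof -
    have "k * card S + 2 \<le> card (C ` W)" using comps by (simp add: num_components_eq C_def W_def)
    then have "real (k * card S + 2) \<le> card (C ` W)" by (simp only: of_nat_le_iff)
    then have "n - s - card (C ` W) \<le> M - 1" by (simp add: M_def s_def)
    then show ?thesis using M1 by (intro add_left_mono mult_right_mono) auto
  qed
  finally have sq: "(\<Sum>X\<in>C ` W. real (card X) * card X) \<le> (n - s) + (M - 1) * M" .
  have "sum d W \<le> (\<Sum>v\<in>W. (s - 1) + card (C v))" by (intro sum_mono dW)
  also have "\<dots> = (s - 1) * (n - s) + (\<Sum>v\<in>W. real (card (C v)))"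
    by (simp add: sum.distrib cardW)
  also have "(\<Sum>v\<in>W. real (card (C v))) = (\<Sum>X\<in>C ` W. real (card X) * card X)"
    unfolding C_def by (rule sum_over_components[OF G fin(3)])
  finally have "sum d W \<le> s * (n - s) + (M - 1) * M" using sq by (simp add: algebra_simps)
  moreover have "sum d S \<le> s * (n - 1)"
    using sum_bounded_above[of S d "n - 1"] dS by (simp add: s_def)
  moreover have "sum d V = sum d W + sum d S"
    unfolding W_def by (rule sum.subset_diff[OF S fin(1)])
  ultimately have "sum d V \<le> s * (n - 1) + s * (n - s) + (M - 1) * M" by linarith
  also have "\<dots> = (n - k * s - 1) * (n - k * s - 2) + 2 * s * (k * s + 1)"
    by (simp add: M_def algebra_simps)
  finally show "(\<Sum>v\<in>V. real (Defs.degree V E v)) \<le> (n - k * s - 1) * (n - k * s - 2) + 2 * s * (k * s + 1)"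
    by (simp add: d_def)
qed

text \<open>The polynomial on the left is convex in \<open>s\<close>; the bound on \<open>n\<close> makes its value at
  \<open>s = 2\<close> dominate the one at the other end of the range, \<open>s = (n - 2) / (k + 1)\<close>.\<close>

lemma cut_size_two_extremal:
  fixes n k s :: real
  assumes "k > 0" "2 \<le> s" "s + k * s + 2 \<le> n" "n \<ge> 2 * k + 7 + 5 / k + 2 / k\<^sup>2"
  shows "(n - k * s - 1) * (n - k * s - 2) + 2 * s * (k * s + 1)
    \<le> (n - k * 2 - 1) * (n - k * 2 - 2) + 2 * 2 * (k * 2 + 1)"
proof -
  have "k\<^sup>2 * (2 * k + 7 + 5 / k + 2 / k\<^sup>2) = 2 * k ^ 3 + 7 * k\<^sup>2 + 5 * k + 2"
    using assms(1) by (simp add: field_simps power2_eq_square power3_eq_cube)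
  then have n: "2 * k ^ 3 + 7 * k\<^sup>2 + 5 * k + 2 \<le> k\<^sup>2 * n"
    using mult_left_mono[OF assms(4), of "k\<^sup>2"] by simp
  \<comment> \<open>This inserts \<open>s \<le> (n - 2) / (k + 1)\<close>; what then remains to be
    shown is exactly the preceding bound on \<open>k\<^sup>2 * n\<close>.\<close>
  have "(k\<^sup>2 + 2 * k) * ((k + 1) * s) \<le> (k\<^sup>2 + 2 * k) * (n - 2)"
    using assms by (intro mult_left_mono) (auto simp: algebra_simps)
  then have "(k + 1) * ((k\<^sup>2 + 2 * k) * (s + 2)) \<le> (k + 1) * (k * (2 * n - 3) - 2)"
    using n by (simp add: algebra_simps power2_eq_square power3_eq_cube)
  then have "(k\<^sup>2 + 2 * k) * (s + 2) \<le> k * (2 * n - 3) - 2"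
    using assms(1) by simp
  \<comment> \<open>The product is the right-hand side of the claim minus its left-hand
    side.\<close>
  then have "0 \<le> (s - 2) * (k * (2 * n - 3) - 2 - (k\<^sup>2 + 2 * k) * (s + 2))"
    using assms by simp
  then show ?thesis by (simp add: algebra_simps power2_eq_square)
qed

section \<open>From a failure of toughness to the theorem\<close>

lemma not_tough_large_cut:
  assumes "simple_graph V E" "connected_graph V E" "\<tau> > 0" "1 / \<tau> = real k" "\<not> tough \<tau> V E"
  obtains S where "S \<subseteq> V" "card S \<ge> 1" "num_components (V - S) E \<ge> k * card S + 2"
proof -
  obtain S where S: "S \<subset> V" "num_components (V - S) E > 1"
    "real (card S) < \<tau> * (real (num_components (V - S) E) - 1)"
    using assms(5) by (auto simp: tough_def not_le)
  define c where "c = num_components (V - S) E"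
  have "(1 / \<tau>) * real (card S) < real c - 1"
    using S(3) assms(3) by (simp add: c_def field_simps)
  then have "real (k * card S + 1) < real c" by (simp add: assms(4))
  \<comment> \<open>Integrality of \<open>1 / \<tau>\<close> enters here: a strict inequality
    between natural numbers supplies the \<open>+ 2\<close>.\<close>
  then have "k * card S + 1 < c" by (simp only: of_nat_less_iff)
  \<comment> \<open>Removing nothing leaves the connected graph, which has one component.\<close>
  moreover have "S \<noteq> {}" using S(2) assms(2) by (auto simp: connected_graph_def)
  then have "card S > 0"
    using S(1) assms(1) finite_subset by (auto simp: card_gt_0_iff simple_graph_def)
  ultimately show ?thesis using that[of S] S(1) by (auto simp: c_def)
qed

lemma rho_alpha_is_eigenvalue:
  assumes "simple_graph V E" "V \<noteq> {}"
  shows "is_eigenvalue_on V (A_alpha \<alpha> V E) (rho_alpha \<alpha> V E)"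
    and "is_eigenvalue_on V (A_alpha \<alpha> V E) r \<Longrightarrow> r \<le> rho_alpha \<alpha> V E"
proof -
  have "A_alpha \<alpha> V E u v = A_alpha \<alpha> V E v u" for u v
    using assms(1) by (auto simp: A_alpha_def simple_graph_def)
  note * = eigenvalues_on_finite_nonempty[OF _ assms(2), of "A_alpha \<alpha> V E", OF _ this]
  have "finite V" using assms(1) by (simp add: simple_graph_def)
  with Max_in[OF *] show "is_eigenvalue_on V (A_alpha \<alpha> V E) (rho_alpha \<alpha> V E)"
    by (simp add: rho_alpha_def)
  show "r \<le> rho_alpha \<alpha> V E" if "is_eigenvalue_on V (A_alpha \<alpha> V E) r"
    unfolding rho_alpha_def using *(1) \<open>finite V\<close> that by (intro Max_ge) auto
qed

lemma simple_ext_graph: "simple_graph {0..<n} (ext_graph_edges n k)"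
  by (auto simp: simple_graph_def ext_graph_edges_def)

text \<open>After clearing denominators, the claim with \<open>D\<close> at its upper bound, the
  value for cuts of size two, is the hypothesis on \<open>n\<close>.\<close>

lemma degree_sum_bound_le:
  fixes \<alpha> n k D :: real
  assumes "k > 0" "n > 1" "\<alpha> \<le> 1" and den: "(1 - 2 * \<alpha>) + (3 - 4 * \<alpha>) * k > 0"
    and n: "n \<ge> ((5 - 6 * \<alpha>) + (13 - 14 * \<alpha>) * k + 4 * (1 - \<alpha>) * k\<^sup>2)
      / ((1 - 2 * \<alpha>) + (3 - 4 * \<alpha>) * k)"
    and D: "D \<le> (n - k * 2 - 1) * (n - k * 2 - 2) + 2 * 2 * (k * 2 + 1)"
  shows "\<alpha> * (n - 1) + (1 - \<alpha>) * (D / (n - 1) - 1) \<le> n - k - 2"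
proof -
  have "(5 - 6 * \<alpha>) + (13 - 14 * \<alpha>) * k + 4 * (1 - \<alpha>) * k\<^sup>2
      \<le> n * ((1 - 2 * \<alpha>) + (3 - 4 * \<alpha>) * k)"
    using n den by (simp add: pos_divide_le_eq)
  moreover have "(1 - \<alpha>) * D \<le> (1 - \<alpha>) * ((n - k * 2 - 1) * (n - k * 2 - 2) + 2 * 2 * (k * 2 + 1))"
    using D assms by (intro mult_left_mono) auto
  ultimately have "(1 - \<alpha>) * D \<le> (n - k - 2 - \<alpha> * (n - 1) + (1 - \<alpha>)) * (n - 1)"
    by (simp add: algebra_simps power2_eq_square)
  then have "(1 - \<alpha>) * (D / (n - 1)) \<le> n - k - 2 - \<alpha> * (n - 1) + (1 - \<alpha>)"
    using \<open>n > 1\<close> by (simp add: pos_divide_le_eq)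
  then show ?thesis by (simp add: algebra_simps)
qed

theorem theorem1p2:
  fixes V :: "'a set" and E :: "'a \<Rightarrow> 'a \<Rightarrow> bool"
    and n k :: nat and \<tau> \<alpha> :: real
  assumes "simple_graph V E"
    and "connected_graph V E"
    and "card V = n"
    and "\<tau> > 0"
    and "1 / \<tau> = real k"
    and "k \<ge> 2"
    and "1/2 \<le> \<alpha>" and "\<alpha> < (3 + \<tau>) / (4 + 2 * \<tau>)"
    and "real n \<ge> 2 * \<tau>^2 + 5 * \<tau> + 2 / \<tau> + 8"
    and "real n \<ge> ((5 - 6 * \<alpha>) * \<tau>^2 + (13 - 14 * \<alpha>) * \<tau> + 4 * (1 - \<alpha>))
                    / ((1 - 2 * \<alpha>) * \<tau>^2 + (3 - 4 * \<alpha>) * \<tau>)"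
    and "rho_alpha \<alpha> V E \<ge> rho_alpha \<alpha> {0..<n} (ext_graph_edges n k)"
  shows "tough \<tau> V E \<or> graph_iso V E {0..<n} (ext_graph_edges n k)"
proof (rule disjCI)
  assume not_iso: "\<not> graph_iso V E {0..<n} (ext_graph_edges n k)"
  show "tough \<tau> V E"
  proof (rule ccontr)
    assume "\<not> tough \<tau> V E"
    with assms obtain S where S: "S \<subseteq> V" "card S \<ge> 1" "num_components (V - S) E \<ge> k * card S + 2"
      by (auto elim: not_tough_large_cut)
    have k: "real k > 0" using assms(6) by simp
    have "\<tau> * k = 1" using assms(4) by (simp flip: assms(5))
    then have \<tau>: "\<tau> = 1 / k" using k by (simp add: eq_divide_eq)
    \<comment> \<open>The upper bound on \<open>\<alpha>\<close> says precisely that the denominator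
      in the second bound on \<open>n\<close> is positive.\<close>
    have "\<alpha> * (4 + 2 * \<tau>) < 3 + \<tau>" using assms(4,8) by (simp add: pos_less_divide_eq)
    from mult_strict_right_mono[OF this k]
    have den: "(1 - 2 * \<alpha>) + (3 - 4 * \<alpha>) * k > 0"
      using k by (simp add: \<tau> algebra_simps)
    have "\<alpha> < 1"
    proof -
      have "(3 + \<tau>) / (4 + 2 * \<tau>) < 1" using assms(4) by simp
      with assms(8) show ?thesis by linarith
    qed
    have n1: "real n \<ge> 2 * real k + 7 + 5 / k + 2 / (real k)\<^sup>2" "real n \<ge> 2 * real k + 8"
      using assms(9) k by (auto simp: \<tau> power_divide intro: order_trans[rotated])
    have n2: "real n \<ge> ((5 - 6 * \<alpha>) + (13 - 14 * \<alpha>) * k + 4 * (1 - \<alpha>) * (real k)\<^sup>2)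
        / ((1 - 2 * \<alpha>) + (3 - 4 * \<alpha>) * k)"
    proof -
      have "(5 - 6 * \<alpha>) * \<tau>\<^sup>2 + (13 - 14 * \<alpha>) * \<tau> + 4 * (1 - \<alpha>)
          = ((5 - 6 * \<alpha>) + (13 - 14 * \<alpha>) * k + 4 * (1 - \<alpha>) * (real k)\<^sup>2) / (real k)\<^sup>2"
        and "(1 - 2 * \<alpha>) * \<tau>\<^sup>2 + (3 - 4 * \<alpha>) * \<tau> = ((1 - 2 * \<alpha>) + (3 - 4 * \<alpha>) * k) / (real k)\<^sup>2"
        using k by (simp_all add: \<tau> add_divide_distrib power2_eq_square)
      then show ?thesis using assms(10) k by simp
    qed
    have n: "n \<ge> 2 * k + 8" using n1(2) by linarith
    \<comment> \<open>\<open>N\<close> is the order of the clique in the extremal graph;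
      \<open>n \<ge> 2 * k + 8\<close> keeps the subtraction from truncating.\<close>
    define N where "N = n - k - 2"
    have N: "N \<ge> 1" "n = N + k + 2" using n by (auto simp: N_def)
    obtain K where K: "K > real N + 1 - \<alpha>" and
      root: "\<alpha> * (real N + real k + 1) + (1 - \<alpha>)\<^sup>2 * (real N / (K - real N) + (real k + 1) / (K - 1)) = K - 1 + \<alpha>"
      using ext_graph_radius_equation[of \<alpha> N k] assms(7) \<open>\<alpha> < 1\<close> N(1) by auto
    have KN: "real N < K" using K \<open>\<alpha> < 1\<close> by linarith
    define r where "r = rho_alpha \<alpha> V E"
    have "V \<noteq> {}" using assms(3) N(2) by auto
    then have r: "is_eigenvalue_on V (A_alpha \<alpha> V E) r"
      unfolding r_def by (rule rho_alpha_is_eigenvalue(1)[OF assms(1)])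
    have "K - 1 + \<alpha> \<le> rho_alpha \<alpha> {0..<n} (ext_graph_edges n k)"
      using rho_alpha_is_eigenvalue(2)[OF simple_ext_graph] ext_graph_eigenvalue[OF N(1) KN root] N(2)
      by simp
    then have Kr: "K - 1 + \<alpha> \<le> r" using assms(11) by (simp add: r_def)
    show False
    proof (cases "card S = 1")
      case True
      then obtain w where "S = {w}" by (auto simp: card_1_singleton_iff)
      then show False
        using cut_vertex_graph_iso[OF assms(1,2) _ N(1) _ _ _ \<open>\<alpha> < 1\<close> KN root r Kr, of w]
          S assms(3,7) N(2) not_iso by simp
    next
      case False
      define s where "s = real (card S)"
      have s: "2 \<le> s" using False S(2) by (simp add: s_def)
      have "real (card S + k * card S + 2) \<le> real n"
        using degree_sum_le(2)[OF assms(1) S(1,3)] assms(3) by (simp only: of_nat_le_iff)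
      then have sn: "s + k * s + 2 \<le> n" by (simp add: s_def)
      have "(\<Sum>v\<in>V. real (Defs.degree V E v)) \<le> (real n - k * s - 1) * (real n - k * s - 2) + 2 * s * (k * s + 1)"
        using degree_sum_le(1)[OF assms(1) S(1,3)] by (simp add: s_def assms(3))
      also have "\<dots> \<le> (real n - real k * 2 - 1) * (real n - real k * 2 - 2) + 2 * 2 * (real k * 2 + 1)"
        by (rule cut_size_two_extremal[OF k s sn n1(1)])
      finally have D: "(\<Sum>v\<in>V. real (Defs.degree V E v))
        \<le> (real n - real k * 2 - 1) * (real n - real k * 2 - 2) + 2 * 2 * (real k * 2 + 1)" by simp
      have "r \<le> \<alpha> * (real n - 1) + (1 - \<alpha>) * ((\<Sum>v\<in>V. real (Defs.degree V E v)) / (real n - 1) - 1)"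
        using eigenvalue_le_degree_sum[OF assms(1,2) _ assms(7) _ r] \<open>\<alpha> < 1\<close> assms(3) n by simp
      also have "\<dots> \<le> real n - k - 2"
        using degree_sum_bound_le[OF k _ _ den n2 D] n \<open>\<alpha> < 1\<close> by simp
      \<comment> \<open>The bound \<open>n - k - 2\<close> equals \<open>N\<close>, whereas
        \<open>K > N + 1 - \<alpha>\<close> gives \<open>r > N\<close>.\<close>
      finally show False using Kr K N(2) by simp
    qed
  qed
qed

end
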